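(* For $n\geq1$, $a_n(312,4321:213)=T_{n+2}+T_{n+1}-1$, where $T_n$ is the $n$-th Tribonacci number.
   Context: $\mathcal{S}_n$ is the set of permutations of $\{1,\ldots,n\}$ in one-line form; $\pi^2=\pi\circ\pi$. A permutation contains a pattern $\sigma\in\mathcal{S}_k$ if some subsequence of it (not necessarily consecutive) has the same relative order as $\sigma$; otherwise it avoids $\sigma$. $a_n(312,4321:\sigma)$ is the number of $\pi\in\mathcal{S}_n$ such that $\pi$ avoids both $312$ and $4321$ and $\pi^2$ avoids $\sigma$. Tribonacci numbers: $T_0=T_1=0$, $T_2=1$, $T_n=T_{n-1}+T_{n-2}+T_{n-3}$ for $n\ge3$. *)

theory Defs
  imports "HOL-Combinatorics.Permutations" "HOL-Library.Sublist"
begin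

definition one_line :: "nat \<Rightarrow> (nat \<Rightarrow> nat) \<Rightarrow> nat list" where
  "one_line n p = map p [1..<Suc n]"

definition same_relative_order :: "nat list \<Rightarrow> nat list \<Rightarrow> bool" where
  "same_relative_order xs ys \<longleftrightarrow>
     length xs = length ys \<and>
     (\<forall>i < length xs. \<forall>j < length xs. xs ! i < xs ! j \<longleftrightarrow> ys ! i < ys ! j)"

(* Patterns are given in one-line form; subseq allows non-consecutive subsequences. *)
definition contains_pattern :: "nat list \<Rightarrow> nat list \<Rightarrow> bool" where
  "contains_pattern xs \<sigma> \<longleftrightarrow> (\<exists>ys. subseq ys xs \<and> same_relative_order ys \<sigma>)"

abbreviation avoids_pattern :: "nat list \<Rightarrow> nat list \<Rightarrow> bool" where
  "avoids_pattern xs \<sigma> \<equiv> \<not> contains_pattern xs \<sigma>"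

(* num_avoiders n B \<sigma> is a_n(B : \<sigma>): the permutations themselves avoid
   every pattern in B, and their squares avoid \<sigma>. *)
definition num_avoiders :: "nat \<Rightarrow> nat list set \<Rightarrow> nat list \<Rightarrow> nat" where
  "num_avoiders n B \<sigma> =
     card {p. p permutes {1..n} \<and>
              (\<forall>\<tau>\<in>B. avoids_pattern (one_line n p) \<tau>) \<and>
              avoids_pattern (one_line n (p \<circ> p)) \<sigma>}"

fun tribonacci :: "nat \<Rightarrow> nat" where
  "tribonacci 0 = 0"
| "tribonacci (Suc 0) = 0"
| "tribonacci (Suc (Suc 0)) = 1"
| "tribonacci (Suc (Suc (Suc n))) =
     tribonacci (Suc (Suc n)) + tribonacci (Suc n) + tribonacci n"

end

theory Submission
  imports Defs
begin

text \<open>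
  Call \<open>p\<close> good of size \<open>n\<close> if it is one of the permutations being counted. The proof cuts off the part
  of the one-line form up to the value 1.

  Let \<open>p k = 1\<close>. Everything after position \<open>k\<close> exceeds everything before it, as a larger entry, then 1,
  then an intermediate entry would form 312; hence \<open>p\<close> is a direct sum of a permutation of \<open>{1..k}\<close>
  ending in 1 and a permutation of the rest (\<open>initial_segment_closed\<close>). If the rest is not empty, its
  last position has a large value under the square, so a descent of the square inside the first block
  would form 213. The square is therefore increasing on the block, hence the identity there
  (\<open>square_identity_before_1\<close>), which forces \<open>p 1 = k\<close>. Two entries strictly between \<open>p 1 = k\<close> and
  \<open>p k = 1\<close> would form 312 with \<open>k\<close> if increasing, and 4321 with both ends if decreasing. So \<open>k \<le> 3\<close>
  and the block is one of 1, 21, 321. Conversely, prefixing such a block to a good permutation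
  keeps it good (\<open>good_glue_iff\<close>).

  What remains is the case \<open>p n = 1\<close>, \<open>p 1 \<noteq> n\<close>. Comparing \<open>p\<close> with the cycle \<open>2 3 \<dots> n 1\<close> at the first
  position where they differ leaves only two permutations for each \<open>n \<ge> 4\<close>: the cycle itself, and
  a variant in which two adjacent entries are exchanged (\<open>exceptional_cases\<close>). For \<open>n = 3\<close> only
  231 occurs, and for \<open>n \<le> 2\<close> nothing does.

  Hence the number \<open>a n\<close> of good permutations satisfies
  \<open>a n = a (n - 1) + a (n - 2) + a (n - 3) + 2\<close> for \<open>n \<ge> 4\<close>, with \<open>a 1 = 1\<close>, \<open>a 2 = 2\<close>, \<open>a 3 = 5\<close>.
  The sequence \<open>T (n + 2) + T (n + 1) - 1\<close> has the same initial values, and it has the same recurrence: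
  the Tribonacci terms cancel, and the constants leave \<open>- 1 + 3 = 2\<close>.
\<close>

section \<open>Pattern containment by positions\<close>

lemma subseq_map_iff: "subseq ys (map f xs) \<longleftrightarrow> (\<exists>zs. subseq zs xs \<and> ys = map f zs)"
  by (metis nths_map subseq_conv_nths)

lemma subseq_upt_iff:
  "subseq ns [a..<b] \<longleftrightarrow> sorted_wrt (<) ns \<and> set ns \<subseteq> {a..<b}"
proof
  assume "subseq ns [a..<b]"
  then obtain N where N: "ns = nths [a..<b] N" by (auto simp: subseq_conv_nths)
  have "sorted ns" "distinct ns"
    unfolding N by (simp_all add: sorted_nths distinct_nthsI)
  moreover have "set ns \<subseteq> {a..<b}"
    using set_nths_subset[of "[a..<b]" N] by (simp add: N)
  ultimately show "sorted_wrt (<) ns \<and> set ns \<subseteq> {a..<b}"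
    by (simp add: strict_sorted_iff)
next
  assume "sorted_wrt (<) ns \<and> set ns \<subseteq> {a..<b}"
  then show "subseq ns [a..<b]" by (intro sorted_subset_imp_subseq) auto
qed

lemma contains_pattern_one_line_iff:
  "contains_pattern (one_line n p) \<sigma> \<longleftrightarrow>
     (\<exists>ns. sorted_wrt (<) ns \<and> set ns \<subseteq> {1..n} \<and> same_relative_order (map p ns) \<sigma>)"
  unfolding contains_pattern_def one_line_def subseq_map_iff subseq_upt_iff
  by (auto simp: atLeastLessThanSuc_atLeastAtMost)

lemma contains_pattern_3_iff:
  "contains_pattern (one_line n p) [x, y, z] \<longleftrightarrow>
     (\<exists>a b c. 1 \<le> a \<and> a < b \<and> b < c \<and> c \<le> n \<and>
        same_relative_order [p a, p b, p c] [x, y, z])"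
  (is "?L \<longleftrightarrow> ?R")
proof
  assume ?L
  then obtain ns where ns: "sorted_wrt (<) ns" "set ns \<subseteq> {1..n}"
      "same_relative_order (map p ns) [x, y, z]"
    by (auto simp: contains_pattern_one_line_iff)
  moreover have "length ns = 3"
    using ns(3) by (simp add: same_relative_order_def)
  then obtain a b c where "ns = [a, b, c]"
    by (auto simp: numeral_3_eq_3 length_Suc_conv)
  ultimately show ?R by fastforce
next
  assume ?R
  then obtain a b c where "1 \<le> a" "a < b" "b < c" "c \<le> n"
      "same_relative_order [p a, p b, p c] [x, y, z]" by blast
  then show ?L
    unfolding contains_pattern_one_line_iff by (intro exI[of _ "[a, b, c]"]) auto
qed

lemma contains_pattern_4_iff:
  "contains_pattern (one_line n p) [w, x, y, z] \<longleftrightarrow>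
     (\<exists>a b c d. 1 \<le> a \<and> a < b \<and> b < c \<and> c < d \<and> d \<le> n \<and>
        same_relative_order [p a, p b, p c, p d] [w, x, y, z])"
  (is "?L \<longleftrightarrow> ?R")
proof
  assume ?L
  then obtain ns where ns: "sorted_wrt (<) ns" "set ns \<subseteq> {1..n}"
      "same_relative_order (map p ns) [w, x, y, z]"
    by (auto simp: contains_pattern_one_line_iff)
  moreover have "length ns = 4"
    using ns(3) by (simp add: same_relative_order_def)
  then obtain a b c d where "ns = [a, b, c, d]"
    by (auto simp: eval_nat_numeral length_Suc_conv)
  ultimately show ?R by fastforce
next
  assume ?R
  then obtain a b c d where "1 \<le> a" "a < b" "b < c" "c < d" "d \<le> n"
      "same_relative_order [p a, p b, p c, p d] [w, x, y, z]" by blast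
  then show ?L
    unfolding contains_pattern_one_line_iff by (intro exI[of _ "[a, b, c, d]"]) auto
qed

lemma same_relative_order_patterns:
  "same_relative_order [x, y, z] [3, 1, 2] \<longleftrightarrow> y < z \<and> z < x"
  "same_relative_order [x, y, z] [2, 1, 3] \<longleftrightarrow> y < x \<and> x < z"
  "same_relative_order [w, x, y, z] [4, 3, 2, 1] \<longleftrightarrow> z < y \<and> y < x \<and> x < w"
  by (auto simp: same_relative_order_def All_less_Suc)

section \<open>The permutations being counted\<close>

definition good :: "nat \<Rightarrow> (nat \<Rightarrow> nat) \<Rightarrow> bool" where
  "good n p \<longleftrightarrow> p permutes {1..n} \<and>
     (\<forall>a b c. 1 \<le> a \<and> a < b \<and> b < c \<and> c \<le> n \<longrightarrow> \<not> (p b < p c \<and> p c < p a)) \<and>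
     (\<forall>a b c d. 1 \<le> a \<and> a < b \<and> b < c \<and> c < d \<and> d \<le> n \<longrightarrow>
        \<not> (p d < p c \<and> p c < p b \<and> p b < p a)) \<and>
     (\<forall>a b c. 1 \<le> a \<and> a < b \<and> b < c \<and> c \<le> n \<longrightarrow>
        \<not> (p (p b) < p (p a) \<and> p (p a) < p (p c)))"

lemma num_avoiders_eq_card_good:
  "num_avoiders n {[3,1,2], [4,3,2,1]} [2,1,3] = card {p. good n p}"
  unfolding num_avoiders_def good_def ball_simps contains_pattern_3_iff contains_pattern_4_iff
    same_relative_order_patterns comp_apply
  by (rule arg_cong[where f = card]) blast

lemma goodD:
  assumes "good n p"
  shows good_permutes: "p permutes {1..n}"
    and good_312: "\<lbrakk>1 \<le> a; a < b; b < c; c \<le> n; p b < p c; p c < p a\<rbrakk> \<Longrightarrow> False"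
    and good_4321: "\<lbrakk>1 \<le> a; a < b; b < c; c < d; d \<le> n; p d < p c; p c < p b; p b < p a\<rbrakk> \<Longrightarrow> False"
    and good_213_square: "\<lbrakk>1 \<le> a; a < b; b < c; c \<le> n; p (p b) < p (p a); p (p a) < p (p c)\<rbrakk> \<Longrightarrow> False"
  using assms unfolding good_def by blast+

lemma finite_good: "finite {p. good n p}"
  by (rule finite_subset[OF _ finite_permutations[of "{1..n}"]]) (auto simp: good_def)

section \<open>Prefixing a decreasing block\<close>

text \<open>The direct sum of the decreasing permutation of \<open>{1..k}\<close> and \<open>q\<close>. The last branch concerns
\<open>x = 0\<close> only and makes it a fixed point, as \<open>permutes\<close> requires.\<close>

definition glue :: "nat \<Rightarrow> (nat \<Rightarrow> nat) \<Rightarrow> nat \<Rightarrow> nat" where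
  "glue k q x = (if 1 \<le> x \<and> x \<le> k then k + 1 - x else if k < x then q (x - k) + k else x)"

text \<open>Keeps natural-number subtraction harmless below: \<open>q (x - k)\<close> is positive exactly when \<open>x > k\<close>.\<close>

lemma permutes_interval_pos:
  fixes q :: "nat \<Rightarrow> nat"
  assumes "q permutes {1..n}"
  shows "0 < q x \<longleftrightarrow> 0 < x"
proof -
  have "q 0 = 0" using assms by (simp add: permutes_not_in)
  then have "q x = 0 \<longleftrightarrow> x = 0" using permutes_inj[OF assms] by (metis injD)
  then show ?thesis by (metis not_gr_zero)
qed

lemma glue_le: "1 \<le> x \<Longrightarrow> x \<le> k \<Longrightarrow> glue k q x = k + 1 - x"
  and glue_gt: "k < x \<Longrightarrow> glue k q x = q (x - k) + k"
  by (auto simp: glue_def)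

lemma glue_square:
  assumes "q permutes {1..n}"
  shows "1 \<le> x \<Longrightarrow> x \<le> k \<Longrightarrow> glue k q (glue k q x) = x"
    and "k < x \<Longrightarrow> glue k q (glue k q x) = q (q (x - k)) + k"
  using permutes_interval_pos[OF assms, of "x - k"] by (auto simp: glue_def)

lemma glue_permutes:
  assumes q: "q permutes {1..n}"
  shows "glue k q permutes {1..n + k}"
proof (rule inj_imp_permutes)
  show "inj_on (glue k q) {1..n + k}"
  proof (rule inj_onI)
    fix x y assume "x \<in> {1..n + k}" "y \<in> {1..n + k}" and eq: "glue k q x = glue k q y"
    then show "x = y"
      using permutes_interval_pos[OF q, of "x - k"] permutes_interval_pos[OF q, of "y - k"]
        inj_eq[OF permutes_inj[OF q], of "x - k" "y - k"]
      by (auto simp: glue_def split: if_splits)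
  qed
  show "glue k q x \<in> {1..n + k}" if "x \<in> {1..n + k}" for x
    using that permutes_in_image[OF q, of "x - k"] by (auto simp: glue_def)
  show "glue k q x = x" if "x \<notin> {1..n + k}" for x
  proof -
    have "q (x - k) = x - k" by (rule permutes_not_in[OF q]) (use that in auto)
    with that show ?thesis by (auto simp: glue_def)
  qed
qed auto

text \<open>The first block lies below all the rest, in \<open>glue k q\<close> and in its square. Each forbidden pattern
starting in the block has its last letter, or for 213 its middle letter, below its first, so this
letter lies in the block too. But the block is decreasing, which excludes 312; it has at most three
entries, which excludes 4321; and its square is the identity, which excludes 213. So forbidden
patterns occur in the part coming from \<open>q\<close> only.\<close>

lemma good_glue_iff:
  assumes q: "q permutes {1..n}" and k: "k \<le> 3"
  shows "good (n + k) (glue k q) \<longleftrightarrow> good n q"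
proof
  let ?p = "glue k q"
  note pos = permutes_interval_pos[OF q]
  assume g: "good n q"
  have small: "x \<le> k" if "1 \<le> x" "?p x \<le> k" for x
    using that pos[of "x - k"] by (auto simp: glue_def split: if_splits)
  have small2: "x \<le> k" if "1 \<le> x" "?p (?p x) \<le> k" for x
    using that glue_square(2)[OF q, of k x] pos[of "x - k"] pos[of "q (x - k)"]
    by (cases "x \<le> k") simp_all
  show "good (n + k) ?p"
    unfolding good_def
  proof (intro conjI allI impI notI; (elim conjE)?)
    show "?p permutes {1..n + k}" by (rule glue_permutes[OF q])
  next
    fix a b c assume *: "1 \<le> a" "a < b" "b < c" "c \<le> n + k" "?p b < ?p c" "?p c < ?p a"
    show False
    proof (cases "a \<le> k")
      case True
      then have "?p a \<le> k" using * by (simp add: glue_le)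
      with * have "c \<le> k" using small[of c] by simp
      with * show False by (simp add: glue_le)
    next
      case False
      then show False
        by (intro good_312[OF g, of "a - k" "b - k" "c - k"]) (use * in \<open>auto simp: glue_gt\<close>)
    qed
  next
    fix a b c d
    assume *: "1 \<le> a" "a < b" "b < c" "c < d" "d \<le> n + k" "?p d < ?p c" "?p c < ?p b" "?p b < ?p a"
    show False
    proof (cases "a \<le> k")
      case True
      then have "?p a \<le> k" using * by (simp add: glue_le)
      with * have "d \<le> k" using small[of d] by simp
      with * k show False by simp
    next
      case False
      then show False
        by (intro good_4321[OF g, of "a - k" "b - k" "c - k" "d - k"]) (use * in \<open>auto simp: glue_gt\<close>)
    qed
  next
    fix a b c
    assume *: "1 \<le> a" "a < b" "b < c" "c \<le> n + k"
      "?p (?p b) < ?p (?p a)" "?p (?p a) < ?p (?p c)"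
    show False
    proof (cases "a \<le> k")
      case True
      with * have "b \<le> k" using small2[of b] by (simp add: glue_square[OF q])
      with * True show False by (simp add: glue_square[OF q])
    next
      case False
      then show False
        by (intro good_213_square[OF g, of "a - k" "b - k" "c - k"])
          (use * in \<open>auto simp: glue_square[OF q]\<close>)
    qed
  qed
next
  assume g: "good (n + k) (glue k q)"
  show "good n q"
    unfolding good_def
  proof (intro conjI allI impI notI; (elim conjE)?)
    fix a b c assume *: "1 \<le> a" "a < b" "b < c" "c \<le> n" "q b < q c" "q c < q a"
    then show False using good_312[OF g, of "a + k" "b + k" "c + k"] by (simp add: glue_gt)
  next
    fix a b c d assume *: "1 \<le> a" "a < b" "b < c" "c < d" "d \<le> n" "q d < q c" "q c < q b" "q b < q a"
    then show False using good_4321[OF g, of "a + k" "b + k" "c + k" "d + k"] by (simp add: glue_gt)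
  next
    fix a b c
    assume *: "1 \<le> a" "a < b" "b < c" "c \<le> n" "q (q b) < q (q a)" "q (q a) < q (q c)"
    then show False
      using good_213_square[OF g, of "a + k" "b + k" "c + k"] by (simp add: glue_square[OF q])
  qed (rule q)
qed

lemma glue_inject:
  assumes "glue k q = glue k q'" "q permutes {1..n}" "q' permutes {1..n}"
  shows "q = q'"
proof
  fix x show "q x = q' x"
  proof (cases "x = 0")
    case True then show ?thesis using assms(2,3) by (simp add: permutes_not_in)
  next
    case False then show ?thesis using fun_cong[OF assms(1), of "x + k"] by (simp add: glue_gt)
  qed
qed

lemma card_glue_image:
  "card (glue k ` {q. good n q}) = card {q. good n q}"
  by (intro card_image inj_onI) (auto dest: glue_inject good_permutes)

section \<open>The block that ends with 1\<close>

text \<open>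
The pigeonhole principle for intervals; the lower and upper bounds on values of a permutation
below all come from it.
\<close>

lemma inj_interval_le:
  fixes p :: "nat \<Rightarrow> nat"
  assumes "inj p" "p ` {a..b} \<subseteq> {c..d}"
  shows "Suc b - a \<le> Suc d - c"
  using card_inj_on_le[OF inj_on_subset[OF assms(1)] assms(2)] by simp

text \<open>Monotonicity sends \<open>{1..x}\<close> into \<open>{1..f x}\<close> and \<open>{x..k}\<close> into \<open>{f x..k}\<close>; counting the first gives
\<open>x \<le> f x\<close>, counting the second \<open>f x \<le> x\<close>.\<close>

lemma increasing_self_map_is_identity:
  fixes f :: "nat \<Rightarrow> nat"
  assumes inj: "inj f" and maps: "\<And>x. 1 \<le> x \<Longrightarrow> x \<le> k \<Longrightarrow> 1 \<le> f x \<and> f x \<le> k"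
    and mono: "\<And>a b. 1 \<le> a \<Longrightarrow> a < b \<Longrightarrow> b \<le> k \<Longrightarrow> f a \<le> f b"
    and x: "1 \<le> x" "x \<le> k"
  shows "f x = x"
proof (rule antisym)
  have mono': "f a \<le> f b" if "1 \<le> a" "a \<le> b" "b \<le> k" for a b
    using mono[of a b] that by (cases "a = b") auto
  have "f ` {1..x} \<subseteq> {1..f x}" using maps mono' x by fastforce
  from inj_interval_le[OF inj this] show "x \<le> f x" by simp
  have "f ` {x..k} \<subseteq> {f x..k}" using maps mono' x by fastforce
  from inj_interval_le[OF inj this] show "f x \<le> x" using maps[OF x] x by simp
qed

context
  fixes n p assumes g: "good n p"
begin

lemmas permutes_p = good_permutes[OF g]

lemma good_inj: "inj p" by (rule permutes_inj[OF permutes_p])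

lemma good_eq_iff: "p x = p y \<longleftrightarrow> x = y" using good_inj by (auto dest: injD)

lemma good_ge_1: "1 \<le> x \<Longrightarrow> 1 \<le> p x" using permutes_interval_pos[OF permutes_p, of x] by simp

lemma good_le: "1 \<le> x \<Longrightarrow> x \<le> n \<Longrightarrow> p x \<le> n" using permutes_in_image[OF permutes_p, of x] by simp

lemma good_preimage:
  assumes "1 \<le> y" "y \<le> n"
  obtains x where "1 \<le> x" "x \<le> n" "p x = y"
  using assms permutes_image[OF permutes_p] by (metis atLeastAtMost_iff imageE)

text \<open>For \<open>a < k < c\<close> the entry 1 at position \<open>k\<close> is the smallest of the three, so avoiding 312 yields
\<open>p a < p c\<close>. As all positions up to \<open>k\<close> carry smaller values than all positions beyond \<open>k\<close>,
counting shows that the values up to \<open>k\<close> are the ones used by the first \<open>k\<close> positions.\<close>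

lemma initial_segment_closed:
  assumes k: "1 \<le> k" "k \<le> n" "p k = 1" and x: "1 \<le> x" "x \<le> n"
  shows "p x \<le> k \<longleftrightarrow> x \<le> k"
proof -
  have less: "p a < p c" if "1 \<le> a" "a \<le> k" "k < c" "c \<le> n" for a c
  proof (rule ccontr)
    assume "\<not> p a < p c"
    with that have "p c < p a" using good_eq_iff[of a c] by simp
    moreover have "p k < p c" using that k good_ge_1[of c] good_eq_iff[of c k] by simp
    ultimately show False
      using good_312[OF g, of a k c] that k by (cases "a = k") auto
  qed
  show ?thesis
  proof
    assume "x \<le> k"
    have "p ` {Suc k..n} \<subseteq> {Suc (p x)..n}"
      using less[OF x(1) \<open>x \<le> k\<close>] k good_le by (auto simp: Suc_le_eq)
    from inj_interval_le[OF good_inj this] show "p x \<le> k" using k good_le[OF x] by linarith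
  next
    assume "p x \<le> k"
    show "x \<le> k"
    proof (rule ccontr)
      assume "\<not> x \<le> k"
      then have "p ` {1..k} \<subseteq> {1..p x - 1}"
        using less[of _ x] x good_ge_1 by fastforce
      from inj_interval_le[OF good_inj this] show False using \<open>p x \<le> k\<close> good_ge_1[OF x(1)] k by simp
    qed
  qed
qed

text \<open>Position \<open>n\<close> lies outside the block and so does its image under the square, which makes it the
letter 3 of a pattern 213 for every descent of the square inside the block.\<close>

lemma square_identity_before_1:
  assumes k: "1 \<le> k" "k < n" "p k = 1" and x: "1 \<le> x" "x \<le> k"
  shows "p (p x) = x"
proof -
  have cl: "p x \<le> k \<longleftrightarrow> x \<le> k" if "1 \<le> x" "x \<le> n" for x
    using initial_segment_closed[of k x] that k by simp
  have "(p \<circ> p) x = x"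
  proof (rule increasing_self_map_is_identity[OF _ _ _ x])
    show "inj (p \<circ> p)" by (intro inj_compose good_inj)
    show "1 \<le> (p \<circ> p) x \<and> (p \<circ> p) x \<le> k" if "1 \<le> x" "x \<le> k" for x
      using that cl[of x] cl[of "p x"] good_ge_1[of x] good_ge_1[of "p x"] k by simp
    show "(p \<circ> p) a \<le> (p \<circ> p) b" if ab: "1 \<le> a" "a < b" "b \<le> k" for a b
    proof (rule ccontr)
      assume "\<not> (p \<circ> p) a \<le> (p \<circ> p) b"
      moreover have "p (p a) \<le> k"
        using ab cl[of a] cl[of "p a"] good_ge_1[of a] k by simp
      moreover have "k < p (p n)"
        using k cl[of n] cl[of "p n"] good_ge_1[of n] good_le[of n] by (metis le_trans less_imp_le not_le le_refl)
      ultimately show False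
        using good_213_square[OF g, of a b n] ab k by simp
    qed
  qed
  then show ?thesis by simp
qed

lemma first_block_reversed:
  assumes k: "1 \<le> k" "k \<le> n" "p k = 1" "p 1 = k"
  shows "k \<le> 3" and "1 \<le> x \<Longrightarrow> x \<le> k \<Longrightarrow> p x = k + 1 - x"
proof -
  have cl: "p x \<le> k \<longleftrightarrow> x \<le> k" if "1 \<le> x" "x \<le> n" for x
    using initial_segment_closed[of k x] that k by simp
  have no_two: False if bc: "1 < b" "b < c" "c < k" for b c
  proof -
    have *: "1 < p y \<and> p y < k" if "1 < y" "y < k" for y
      using that cl[of y] good_eq_iff[of y 1] good_eq_iff[of y k] good_ge_1[of y] k by simp
    show False
      using good_4321[OF g, of 1 b c k] good_312[OF g, of 1 b c] *[of b] *[of c] bc k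
        good_eq_iff[of b c] by (cases "p b" "p c" rule: linorder_cases) auto
  qed
  show k3: "k \<le> 3" using no_two[of 2 3] by (cases "k \<le> 3") simp_all
  show "p x = k + 1 - x" if x: "1 \<le> x" "x \<le> k"
  proof (cases "x = 1 \<or> x = k")
    case True then show ?thesis using k by auto
  next
    case False
    then have "x = 2" "k = 3" using x k3 by auto
    then show ?thesis using cl[of x] good_eq_iff[of x 1] good_eq_iff[of x k] good_ge_1[of x] k x by auto
  qed
qed

text \<open>Cutting off the decreasing block and shifting the remaining positions and values down by \<open>k\<close>
inverts \<open>glue k\<close>.\<close>

lemma glue_decomposition:
  assumes k: "1 \<le> k" "k \<le> n" "p k = 1" "p 1 = k"
  obtains q where "p = glue k q" "good (n - k) q"
proof -
  define q where "q x = (if x = 0 then 0 else p (x + k) - k)" for x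
  have gt: "k < p x" if "k < x" for x
    using initial_segment_closed[OF k(1,2,3), of x] permutes_not_in[OF permutes_p, of x] that k
    by (cases "x \<le> n") auto
  have eq: "p = glue k q"
  proof
    fix x show "p x = glue k q x"
      using first_block_reversed(2)[OF k, of x] gt[of x] permutes_not_in[OF permutes_p, of 0]
      by (cases "x = 0") (auto simp: glue_def q_def)
  qed
  have q: "q permutes {1..n - k}"
  proof (rule inj_imp_permutes)
    show "inj_on q {1..n - k}"
      using gt by (intro inj_onI) (auto simp: q_def eq_diff_iff less_imp_le good_eq_iff)
    show "q x \<in> {1..n - k}" if x: "x \<in> {1..n - k}" for x
    proof -
      have "x + k \<le> n" using x k by auto
      then show ?thesis using x gt[of "x + k"] good_le[of "x + k"] by (auto simp: q_def)
    qed
    show "q x = x" if "x \<notin> {1..n - k}" for x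
      using that permutes_not_in[OF permutes_p, of "x + k"] k by (auto simp: q_def)
  qed simp
  have "good (n - k) q"
    using good_glue_iff[OF q first_block_reversed(1)[OF k]] g k eq by simp
  with eq show ?thesis by (rule that)
qed

text \<open>If \<open>b < s\<close>, then none of the first \<open>b\<close> positions carries \<open>b\<close>, and they cannot all carry smaller
values. So some \<open>c < b\<close> has \<open>p c > b\<close>, and the positions \<open>c < b < s\<close> carry \<open>p c\<close>, \<open>p b\<close>, \<open>b\<close>,
a pattern 312.\<close>

lemma preimage_of_anti_excedance:
  assumes b: "1 \<le> b" "b \<le> n" "p b < b" and s: "p s = b"
  shows "s < b"
proof (rule ccontr)
  assume "\<not> s < b"
  with b s have sb: "b < s" by (cases "s = b") auto
  have sn: "s \<le> n" using permutes_not_in[OF permutes_p, of s] s b by (cases "s \<le> n") auto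
  have "\<exists>c. 1 \<le> c \<and> c < b \<and> b < p c"
  proof (rule ccontr)
    assume *: "\<nexists>c. 1 \<le> c \<and> c < b \<and> b < p c"
    have "p c < b" if "1 \<le> c" "c \<le> b" for c
      using * that b good_eq_iff[of c s] s sb by (metis le_neq_implies_less linorder_neqE_nat not_less)
    then have "p ` {1..b} \<subseteq> {1..b - 1}" using good_ge_1 by fastforce
    from inj_interval_le[OF good_inj this] show False using b by simp
  qed
  then obtain c where "1 \<le> c" "c < b" "b < p c" by blast
  then show False using good_312[OF g, of c b s] b s sb sn by simp
qed

end

section \<open>Good permutations with last entry 1\<close>

definition cycle :: "nat \<Rightarrow> nat \<Rightarrow> nat" where
  "cycle n x = (if 1 \<le> x \<and> x < n then x + 1 else if x = n then 1 else x)"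

text \<open>The cycle \<open>2 3 \<dots> n 1\<close> with the entries at positions \<open>i\<close> and \<open>i + 1\<close> exchanged, meant for
\<open>1 \<le> i\<close> and \<open>i + 2 \<le> n\<close>. It leaves \<open>i + 1\<close> fixed.\<close>

definition split_cycle :: "nat \<Rightarrow> nat \<Rightarrow> nat \<Rightarrow> nat" where
  "split_cycle n i x =
     (if x = i then i + 2 else if x = i + 1 then i + 1
      else if 1 \<le> x \<and> x < n then x + 1 else if x = n then 1 else x)"

text \<open>Let \<open>i\<close> be the first position where \<open>p\<close> differs from the cycle. The values \<open>1, \<dots>, i\<close> are then taken, 1 by
position \<open>n\<close>, so \<open>p i > i + 1\<close>; two smaller entries between \<open>i\<close> and \<open>n\<close> are impossible, so
\<open>p i = i + 2\<close>. The square determines the rest. Write \<open>p t = i + 1\<close> and \<open>p s = t\<close>.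
For \<open>i \<ge> 2\<close> the square takes the value \<open>i + 2\<close> at \<open>i - 1\<close> and \<open>i + 1\<close> at \<open>s\<close>, so it takes no
value above \<open>i + 2\<close> after \<open>s\<close>. This forces \<open>t = i + 1\<close> and then \<open>n \<le> i + 3\<close>. The value \<open>i = 1\<close> is excluded separately.\<close>

lemma exceptional_cases:
  assumes g: "good n p" and n: "p n = 1" "p 1 \<noteq> n" "1 \<le> n"
  shows "3 \<le> n \<and> p = cycle n \<or>
    (n = 4 \<and> p = split_cycle 4 2) \<or> (5 \<le> n \<and> p = split_cycle n (n - 3))"
proof -
  note eq_iff = good_eq_iff[OF g] and pos = good_ge_1[OF g] and le = good_le[OF g]
    and outside = permutes_not_in[OF good_permutes[OF g]]
  note sq = good_213_square[OF g]
  show ?thesis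
  proof (cases "\<forall>x. 1 \<le> x \<and> x < n \<longrightarrow> p x = x + 1")
    case True
    then have "p = cycle n" using n outside by (auto simp: cycle_def fun_eq_iff)
    moreover have "3 \<le> n"
    proof (rule ccontr)
      assume "\<not> 3 \<le> n"
      with n have "n = 1 \<or> n = 2" by auto
      then show False using n True by auto
    qed
    ultimately show ?thesis by blast
  next
    case False
    define i where "i = (LEAST x. 1 \<le> x \<and> x < n \<and> p x \<noteq> x + 1)"
    have i: "1 \<le> i" "i < n" "p i \<noteq> i + 1"
      using LeastI_ex[of "\<lambda>x. 1 \<le> x \<and> x < n \<and> p x \<noteq> x + 1"] False unfolding i_def by auto
    have below: "p x = x + 1" if "1 \<le> x" "x < i" for x
      using not_less_Least[of x "\<lambda>x. 1 \<le> x \<and> x < n \<and> p x \<noteq> x + 1"] that i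
      unfolding i_def by auto
    (* The values 2, ..., i are used before position i, and 1 is used at n. *)
    have large: "i < p x" if "i \<le> x" "x < n" for x
    proof (rule ccontr)
      assume *: "\<not> i < p x"
      have "p x \<noteq> 1" using eq_iff[of x n] n that by simp
      then have "1 \<le> p x - 1" "p x - 1 < i" using pos[of x] that i * by auto
      then have "p (p x - 1) = p x" using below[of "p x - 1"] by simp
      then show False using eq_iff[of "p x - 1" x] \<open>p x - 1 < i\<close> that by simp
    qed
    have pre: "\<exists>t. i \<le> t \<and> t < n \<and> p t = y" if y: "i < y" "y \<le> n" for y
    proof -
      obtain t where t: "1 \<le> t" "t \<le> n" "p t = y"
        using good_preimage[OF g, of y] y by auto
      moreover have "i \<le> t" using below[of t] t y by (cases "t < i") auto
      moreover have "t \<noteq> n" using t n y i by auto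
      ultimately show ?thesis by auto
    qed
    have pi: "p i = i + 2"
    proof (rule ccontr)
      assume "p i \<noteq> i + 2"
      with large[of i] i have gt: "i + 2 < p i" by simp
      have "p i \<le> n" using le i by simp
      with gt pre[of "i + 1"] pre[of "i + 2"] obtain t t' where
        t: "i \<le> t" "t < n" "p t = i + 1" and t': "i \<le> t'" "t' < n" "p t' = i + 2" by auto
      have "t \<noteq> i" "t' \<noteq> i" using t t' i gt by auto
      (* Both i + 1 and i + 2 follow the larger entry p i: in increasing order they
         form 312 with it, in decreasing order 4321 with it and the final 1. *)
      show False
        using good_312[OF g, of i t t'] good_4321[OF g, of i t' t n] t t' i gt n
          \<open>t \<noteq> i\<close> \<open>t' \<noteq> i\<close>
        by (cases t t' rule: linorder_cases) auto
    qed
    then have n2: "i + 2 \<le> n" using le[of i] i by simp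
    obtain t where t: "i \<le> t" "t < n" "p t = i + 1" using pre[of "i + 1"] i by auto
    then have t_gt: "i < t" using pi by (cases "t = i") auto
    obtain s where s: "i \<le> s" "s < n" "p s = t" using pre[of t] t t_gt by auto
    have s_lt: "s < t" if "t \<noteq> i + 1"
      using preimage_of_anti_excedance[OF g, of t s] t t_gt that s i by auto
    have after_i: "i + 3 \<le> p x" if "i < x" "x < n" "x \<noteq> t" for x
      using large[of x] that eq_iff[of x i] eq_iff[of x t] pi t by simp
    (* For i = 1 the square takes the values 2 at s and 3 at n. Its value 1 is taken at the
       position j of n, so j may not separate s from n: j <= s. Also j is not 1, as p 1 = 3 < n.
       If t = 2, then s = 2, so j = 2 and n = p 2 = 2. Otherwise j < s < t < n, and the entries
       at s and t follow the maximum: a 312, or a 4321 with the final 1. *)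
    have i_ne_1: "i \<noteq> 1"
    proof
      assume i1: "i = 1"
      then have pn: "p (p n) = 3" using n pi by simp
      have "n \<noteq> 3" using i1 pi n by auto
      obtain j where j: "i \<le> j" "j < n" "p j = n" using pre[of n] i by auto
      have j1: "j \<noteq> i" using j pi i1 \<open>n \<noteq> 3\<close> by auto
      have ps: "p (p s) = 2" using s t i1 by simp
      have "j \<le> s"
      proof (rule ccontr)
        assume "\<not> j \<le> s"
        then show False using sq[of s j n] s j ps pn n i by simp
      qed
      show False
      proof (cases "t = i + 1")
        case True
        then have "s = i + 1" using s t eq_iff by metis
        with \<open>j \<le> s\<close> j j1 True have "j = t" by simp
        then show False using j t i1 True n2 by simp
      next
        case False
        note st = s_lt[OF this]
        have "s \<noteq> j" using s j t by auto
        with \<open>j \<le> s\<close> have js: "j < s" by simp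
        have "p s \<noteq> p t" "p s < p j" "p t < p j"
          using st js s t j i n2 \<open>n \<noteq> 3\<close> i1 by auto
        moreover have "p n < p t" using n t i by simp
        ultimately show False
          using good_312[OF g, of j s t] good_4321[OF g, of j s t n] js st t j i
          by (cases "p s" "p t" rule: linorder_cases) auto
      qed
    qed
    have psq: "p (p (i - 1)) = i + 2" using below[of "i - 1"] i i_ne_1 pi by simp
    (* Otherwise the square takes the values i + 2, i + 1 and at least i + 3
       at i - 1 < s < t. *)
    have t_eq: "t = i + 1"
    proof (rule ccontr)
      assume ne: "t \<noteq> i + 1"
      have "i + 3 \<le> p (p t)" using after_i[of "i + 1"] t t_gt ne n2 by simp
      moreover have "1 \<le> i - 1" "i - 1 < s" using i i_ne_1 s by auto
      ultimately show False
        using sq[of "i - 1" s t] s s_lt[OF ne] t psq by simp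
    qed
    (* The square has i + 2 at i - 1 and i + 1 at i + 1, so later values are smaller still.
       But if p u is not n, then p (p u) is at least i + 3. *)
    have only_n: "p u = n" if u: "i + 1 < u" "u < n" for u
    proof (rule ccontr)
      assume ne: "p u \<noteq> n"
      have "i + 3 \<le> p u" using after_i[of u] u t_eq by simp
      moreover have "p u < n" using ne le[of u] u by simp
      ultimately have "i + 3 \<le> p (p u)" using after_i[of "p u"] t_eq by simp
      moreover have "1 \<le> i - 1" "i - 1 < i + 1" using i i_ne_1 by auto
      ultimately show False using sq[of "i - 1" "i + 1" u] psq t t_eq u by simp
    qed
    have "n \<le> i + 3"
    proof (rule ccontr)
      assume "\<not> n \<le> i + 3"
      then have "p (i + 2) = n" "p (i + 3) = n" using only_n by auto
      then show False using eq_iff[of "i + 2" "i + 3"] by simp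
    qed
    then consider "n = i + 2" | "n = i + 3" using n2 by linarith
    then show ?thesis
    proof cases
      case 1
      (* For i > 2 the positions i - 2 < i < i + 1 of the square carry i, 1, i + 1. *)
      have "i = 2"
      proof (rule ccontr)
        assume "i \<noteq> 2"
        then have i2: "1 \<le> i - 2" "i - 2 < i" "i - 2 + 1 = i - 1" "1 \<le> i - 1" "i - 1 < i"
            "i - 1 + 1 = i" "1 < i"
          using i i_ne_1 by auto
        then have "p (p (i - 2)) = i" using below[of "i - 2"] below[of "i - 1"] by simp
        then show False
          using sq[of "i - 2" i "i + 1"] i2 i t t_eq pi 1 n by simp
      qed
      have "p x = split_cycle n i x" for x
        using below[of x] n t t_eq pi 1 outside[of x] i
        by (cases "x < i") (auto simp: split_cycle_def)
      then have "p = split_cycle 4 2" using 1 \<open>i = 2\<close> by auto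
      then show ?thesis using 1 \<open>i = 2\<close> by simp
    next
      case 2
      have "p x = split_cycle n i x" for x
        using below[of x] n t t_eq pi 2 only_n[of x] outside[of x] i
        by (cases "x < i"; cases "x = i + 2") (auto simp: split_cycle_def)
      then have "p = split_cycle n (n - 3)" using 2 by auto
      then show ?thesis using 2 i i_ne_1 by simp
    qed
  qed
qed

lemma good_cycle:
  assumes n: "3 \<le> n"
  shows "good n (cycle n)"
  unfolding good_def
proof (intro conjI allI impI notI; (elim conjE)?)
  show "cycle n permutes {1..n}"
    by (rule inj_imp_permutes) (use n in \<open>auto simp: cycle_def inj_on_def split: if_splits\<close>)
next
  fix a b c assume "1 \<le> a" "a < b" "b < c" "c \<le> n"
    "cycle n b < cycle n c" "cycle n c < cycle n a"
  then show False by (simp add: cycle_def split: if_splits)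
next
  fix a b c d assume "1 \<le> a" "a < b" "b < c" "c < d" "d \<le> n"
    "cycle n d < cycle n c" "cycle n c < cycle n b" "cycle n b < cycle n a"
  then show False by (simp add: cycle_def split: if_splits)
next
  have sq: "cycle n (cycle n x) = (if x + 1 < n then x + 2 else x + 2 - n)"
    if "1 \<le> x" "x \<le> n" for x using that n by (auto simp: cycle_def)
  fix a b c assume "1 \<le> a" "a < b" "b < c" "c \<le> n"
    "cycle n (cycle n b) < cycle n (cycle n a)" "cycle n (cycle n a) < cycle n (cycle n c)"
  then show False by (simp add: sq split: if_splits)
qed

lemma split_cycle_permutes:
  "1 \<le> i \<Longrightarrow> i + 2 \<le> n \<Longrightarrow> split_cycle n i permutes {1..n}"
    by (rule inj_imp_permutes) (auto simp: split_cycle_def inj_on_def split: if_splits)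

text \<open>Before the final 1, the two exchanged entries are the only ones out of order. A pattern 312 cannot
use the final 1 and needs two inversions; the first three letters of 4321 need three.\<close>

lemma split_cycle_inversion:
  assumes "i + 2 \<le> n" "1 \<le> x" "x < y" "y < n" "split_cycle n i y \<le> split_cycle n i x"
  shows "x = i \<and> y = i + 1"
proof -
  have "split_cycle n i y = (if y = i then i + 2 else if y = i + 1 then i + 1 else y + 1)"
    using assms by (auto simp: split_cycle_def)
  moreover have "split_cycle n i x = (if x = i then i + 2 else if x = i + 1 then i + 1 else x + 1)"
    using assms by (auto simp: split_cycle_def)
  ultimately show ?thesis using assms by (cases "x = i") (auto split: if_splits)
qed

lemma split_cycle_last: "i + 2 \<le> n \<Longrightarrow> split_cycle n i n = 1"
  by (simp add: split_cycle_def)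

lemma split_cycle_pos: "1 \<le> x \<Longrightarrow> 1 \<le> split_cycle n i x"
  by (simp add: split_cycle_def)

lemma good_split_cycleI:
  assumes i: "1 \<le> i" "i + 2 \<le> n"
    and sq: "\<And>a b c. \<lbrakk>1 \<le> a; a < b; b < c; c \<le> n;
      split_cycle n i (split_cycle n i b) < split_cycle n i (split_cycle n i a);
      split_cycle n i (split_cycle n i a) < split_cycle n i (split_cycle n i c)\<rbrakk> \<Longrightarrow> False"
  shows "good n (split_cycle n i)"
  unfolding good_def
proof (intro conjI allI impI notI; (elim conjE)?)
  fix a b c assume "1 \<le> a" "a < b" "b < c" "c \<le> n"
    "split_cycle n i b < split_cycle n i c" "split_cycle n i c < split_cycle n i a"
  then show False
    using split_cycle_inversion[OF i(2), of a c] split_cycle_last[OF i(2)]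
      split_cycle_pos[of b n i] by (cases "c = n") auto
next
  fix a b c d assume "1 \<le> a" "a < b" "b < c" "c < d" "d \<le> n"
    "split_cycle n i d < split_cycle n i c" "split_cycle n i c < split_cycle n i b"
    "split_cycle n i b < split_cycle n i a"
  then show False
    using split_cycle_inversion[OF i(2), of a b] split_cycle_inversion[OF i(2), of b c] by simp
next
  show "split_cycle n i permutes {1..n}" by (rule split_cycle_permutes[OF i])
qed (rule sq)

lemma good_split_cycle_4: "good 4 (split_cycle 4 2)"
proof (rule good_split_cycleI)
  fix a b c :: nat assume *: "1 \<le> a" "a < b" "b < c" "c \<le> 4"
    "split_cycle 4 2 (split_cycle 4 2 b) < split_cycle 4 2 (split_cycle 4 2 a)"
    "split_cycle 4 2 (split_cycle 4 2 a) < split_cycle 4 2 (split_cycle 4 2 c)"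
  have sq: "split_cycle 4 2 (split_cycle 4 2 x) = (if x = 1 then 4 else if x = 2 then 1 else if x = 3 then 3 else 2)"
    if "1 \<le> x" "x \<le> 4" for x using that by (auto simp: split_cycle_def)
  from * show False by (simp add: sq split: if_splits)
qed auto

lemma good_split_cycle:
  assumes n: "5 \<le> n" shows "good n (split_cycle n (n - 3))"
proof (rule good_split_cycleI)
  define i where "i = n - 3"
  have i: "n = i + 3" "2 \<le> i" using n by (auto simp: i_def)
  fix a b c :: nat assume *: "1 \<le> a" "a < b" "b < c" "c \<le> n"
    "split_cycle n (n - 3) (split_cycle n (n - 3) b) < split_cycle n (n - 3) (split_cycle n (n - 3) a)"
    "split_cycle n (n - 3) (split_cycle n (n - 3) a) < split_cycle n (n - 3) (split_cycle n (n - 3) c)"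
  (* In one-line form the square is 3, 4, ..., i, i + 2, i + 3, i + 1, 1, 2. A letter 1 of a pattern
     213 sits at i + 1 or later, and then every later value is at most 2, which is too small for the letter 3. *)
  have sq: "split_cycle n i (split_cycle n i x) =
      (if x < i - 1 then x + 2 else if x = i - 1 then i + 2 else if x = i then i + 3
       else if x = i + 1 then i + 1 else if x = i + 2 then 1 else 2)"
    if "1 \<le> x" "x \<le> i + 3" for x using that i by (auto simp: split_cycle_def)
  from * i have "i + 1 \<le> b"
    using sq[of a] sq[of b] by (simp add: i_def[symmetric] split: if_splits)
  with * i sq[of b] sq[of c] show False
    by (simp add: i_def[symmetric] split: if_splits)
qed (use n in auto)

section \<open>Counting\<close>

abbreviation good_count :: "nat \<Rightarrow> nat" where
  "good_count n \<equiv> card {p. good n p}"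

definition exceptional :: "nat \<Rightarrow> (nat \<Rightarrow> nat) set" where
  "exceptional n = {p. good n p \<and> p n = 1 \<and> p 1 \<noteq> n}"

lemma exceptional_eq:
  assumes "1 \<le> n"
  shows "exceptional n =
    (if n \<le> 2 then {} else if n = 3 then {cycle 3}
     else {cycle n, split_cycle n (if n = 4 then 2 else n - 3)})"
proof -
  have "cycle n \<in> exceptional n" if "3 \<le> n"
    using that good_cycle[of n] by (auto simp: exceptional_def cycle_def)
  moreover have "split_cycle n (if n = 4 then 2 else n - 3) \<in> exceptional n" if "4 \<le> n"
    using that good_split_cycle[of n] good_split_cycle_4
    by (auto simp: exceptional_def split_cycle_def)
  moreover have "\<forall>p \<in> exceptional n. 3 \<le> n \<and> p = cycle n \<or>
      4 \<le> n \<and> p = split_cycle n (if n = 4 then 2 else n - 3)"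
  proof
    fix p assume "p \<in> exceptional n"
    then show "3 \<le> n \<and> p = cycle n \<or>
        4 \<le> n \<and> p = split_cycle n (if n = 4 then 2 else n - 3)"
      using exceptional_cases[of n p] assms by (auto simp: exceptional_def)
  qed
  ultimately have "exceptional n = {p. 3 \<le> n \<and> p = cycle n \<or>
      4 \<le> n \<and> p = split_cycle n (if n = 4 then 2 else n - 3)}" by blast
  then show ?thesis by (cases "n \<le> 2"; cases "n = 3") auto
qed

lemma card_exceptional:
  assumes "1 \<le> n"
  shows "card (exceptional n) = (if n \<le> 2 then 0 else if n = 3 then 1 else 2)"
proof -
  have neq: "cycle n \<noteq> split_cycle n i" if "1 \<le> i" "i + 2 \<le> n" for i
    using that by (auto simp: fun_eq_iff cycle_def split_cycle_def intro!: exI[of _ i])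
  have "cycle n \<noteq> split_cycle n (if n = 4 then 2 else n - 3)" if "4 \<le> n"
    by (rule neq) (use that in auto)
  then show ?thesis
    unfolding exceptional_eq[OF assms] by (cases "n \<le> 2"; cases "n = 3") auto
qed

text \<open>The good permutation of size 0 accounts for the case that \<open>p\<close> is a single decreasing block.\<close>

lemma good_decomposition:
  assumes n: "1 \<le> n"
  shows "{p. good n p} =
    exceptional n \<union> (\<Union>k \<in> {1..min 3 n}. glue k ` {q. good (n - k) q})" (is "?L = ?R")
proof
  show "?R \<subseteq> ?L"
  proof
    fix p assume "p \<in> ?R"
    then consider "p \<in> exceptional n"
      | k q where "k \<in> {1..min 3 n}" "good (n - k) q" "p = glue k q" by blast
    then show "p \<in> ?L"
    proof cases
      case 1
      then show ?thesis by (simp add: exceptional_def)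
    next
      case (2 k q)
      then have "k \<le> 3" "n - k + k = n" by auto
      with good_glue_iff[OF good_permutes[OF 2(2)], of k] 2 show ?thesis by simp
    qed
  qed
  show "?L \<subseteq> ?R"
  proof
    fix p assume "p \<in> ?L"
    then have g: "good n p" by simp
    obtain k where k: "1 \<le> k" "k \<le> n" "p k = 1" using good_preimage[OF g, of 1] n by auto
    show "p \<in> ?R"
    proof (cases "p 1 = k")
      case True
      then obtain q where q: "p = glue k q" "good (n - k) q"
        using glue_decomposition[OF g k] by blast
      have "k \<in> {1..min 3 n}"
        using first_block_reversed(1)[OF g k True] k by simp
      with q show ?thesis by blast
    next
      case False
      then have "k = n"
        using square_identity_before_1[OF g, of k k] k by (cases "k < n") auto
      with False g k show ?thesis by (simp add: exceptional_def)
    qed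
  qed
qed

text \<open>The parts are disjoint: \<open>glue k q\<close> has first entry \<open>k\<close> and the entry 1 at position \<open>k\<close>, so \<open>k\<close> can be
recovered, and if it ends with 1 then \<open>k = n\<close> is its first entry.\<close>

lemma good_count_rec:
  assumes n: "1 \<le> n"
  shows "good_count n = card (exceptional n) + (\<Sum>k = 1..min 3 n. good_count (n - k))"
proof -
  let ?B = "\<lambda>k. glue k ` {q. good (n - k) q}"
  have first: "glue k q 1 = k" "glue k q k = 1" if "1 \<le> k" for k q
    using that by (simp_all add: glue_le)
  have disj: "?B k \<inter> ?B l = {}" if "1 \<le> k" "1 \<le> l" "k \<noteq> l" for k l
    using that by (auto dest: fun_cong[of _ _ 1] simp: glue_le)
  have "exceptional n \<inter> (\<Union>k \<in> {1..min 3 n}. ?B k) = {}"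
  proof -
    have False if "1 \<le> k" "k \<le> n" "good (n - k) q" "glue k q \<in> exceptional n" for k q
    proof -
      have "good n (glue k q)" "glue k q n = 1" "glue k q 1 \<noteq> n"
        using that(4) by (auto simp: exceptional_def)
      then show False
        using good_eq_iff[of n "glue k q" n k] first[OF that(1), of q] by simp
    qed
    then show ?thesis by auto
  qed
  moreover have "finite (exceptional n)"
    by (rule finite_subset[OF _ finite_good[of n]]) (auto simp: exceptional_def)
  ultimately have "good_count n = card (exceptional n) + card (\<Union>k \<in> {1..min 3 n}. ?B k)"
    unfolding good_decomposition[OF n] by (intro card_Un_disjoint) (auto simp: finite_good)
  also have "card (\<Union>k \<in> {1..min 3 n}. ?B k) = (\<Sum>k = 1..min 3 n. card (?B k))"
    by (intro card_UN_disjoint) (use disj in \<open>auto simp: finite_good simp del: min.bounded_iff\<close>)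
  also have "\<dots> = (\<Sum>k = 1..min 3 n. good_count (n - k))"
    by (simp add: card_glue_image)
  finally show ?thesis .
qed

lemma good_count_0: "good_count 0 = 1"
proof -
  have "{p. good 0 p} = {id}" by (auto simp: good_def)
  then show ?thesis by simp
qed

lemma good_count_small: "good_count 1 = 1" "good_count 2 = 2" "good_count 3 = 5"
proof -
  show 1: "good_count 1 = 1"
    using good_count_rec[of 1] by (simp add: card_exceptional good_count_0)
  have "{Suc 0..2} = {1, 2}" "{Suc 0..3} = {1, 2, 3}" by auto
  note iv = this
  show 2: "good_count 2 = 2"
    using good_count_rec[of 2] 1 by (simp add: card_exceptional good_count_0 iv)
  show "good_count 3 = 5"
    using good_count_rec[of 3] 1 2 by (simp add: card_exceptional good_count_0 iv)
qed

lemma good_count_step: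
  assumes "4 \<le> n"
  shows "good_count n = good_count (n - 1) + good_count (n - 2) + good_count (n - 3) + 2"
proof -
  have "{1..min 3 n} = {1, 2, 3}" using assms by auto
  then show ?thesis using good_count_rec[of n] assms by (simp add: card_exceptional)
qed

lemma tribonacci_rec:
  "3 \<le> n \<Longrightarrow> tribonacci n = tribonacci (n - 1) + tribonacci (n - 2) + tribonacci (n - 3)"
  by (cases n rule: tribonacci.cases) simp_all

lemma tribonacci_small:
  "tribonacci 2 = 1" "tribonacci 3 = 1" "tribonacci 4 = 2" "tribonacci 5 = 4"
  using tribonacci_rec[of 3] tribonacci_rec[of 4] tribonacci_rec[of 5] by (simp_all add: numeral_2_eq_2)

lemma good_count_tribonacci:
  "1 \<le> n \<Longrightarrow> good_count n + 1 = tribonacci (n + 2) + tribonacci (n + 1)"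
proof (induction n rule: less_induct)
  case (less n)
  consider "n = 1" | "n = 2" | "n = 3" | "4 \<le> n" using less.prems by linarith
  then show ?case
  proof cases
    case 4
    have shift: "n - 1 + 2 = n + 1" "n - 1 + 1 = n" "n - 2 + 2 = n" "n - 2 + 1 = n - 1"
        "n - 3 + 2 = n - 1" "n - 3 + 1 = n - 2"
        "n + 2 - 1 = n + 1" "n + 2 - 2 = n" "n + 2 - 3 = n - 1"
        "n + 1 - 1 = n" "n + 1 - 2 = n - 1" "n + 1 - 3 = n - 2"
      using 4 by auto
    have "good_count (n - 1) + 1 = tribonacci (n + 1) + tribonacci n"
      "good_count (n - 2) + 1 = tribonacci n + tribonacci (n - 1)"
      "good_count (n - 3) + 1 = tribonacci (n - 1) + tribonacci (n - 2)"
      using less.IH[of "n - 1", unfolded shift] less.IH[of "n - 2", unfolded shift]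
        less.IH[of "n - 3", unfolded shift] 4 by linarith+
    moreover have "tribonacci (n + 2) = tribonacci (n + 1) + tribonacci n + tribonacci (n - 1)"
      "tribonacci (n + 1) = tribonacci n + tribonacci (n - 1) + tribonacci (n - 2)"
      using tribonacci_rec[of "n + 2", unfolded shift] tribonacci_rec[of "n + 1", unfolded shift] 4
      by linarith+
    ultimately show ?thesis using good_count_step[OF 4] by linarith
  qed (use good_count_small tribonacci_small in simp_all)
qed

theorem corollary4p3:
  fixes n :: nat
  assumes "n \<ge> 1"
  shows "int (num_avoiders n {[3,1,2], [4,3,2,1]} [2,1,3]) =
           int (tribonacci (n + 2)) + int (tribonacci (n + 1)) - 1"
  using good_count_tribonacci[OF assms] unfolding num_avoiders_eq_card_good by linarith

end
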